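(* For $\lambda>-\tfrac12$ and $\mu>0$, $$C_n^\lambda(x)=c_\mu\,\sigma_{\lambda,\mu}\int_{-1}^1\int_0^1 C_n^{\lambda+\mu}\bigl(sx+(1-s)y\bigr)\,s^{\lambda-1}(1-s)^{\mu-1}\,ds\;w_\mu(y)\,dy,$$ and, furthermore, $$Z_n^\lambda(x)=c_\mu\,\sigma_{\lambda+1,\mu}\int_{-1}^1\int_0^1 Z_n^{\lambda+\mu}\bigl(sx+(1-s)y\bigr)\,s^{\lambda}(1-s)^{\mu-1}\,ds\;w_\mu(y)\,dy,$$ where $$\sigma_{\lambda,\mu}=\frac{\Gamma(\lambda+\mu)}{\Gamma(\lambda)\Gamma(\mu)}\quad\text{and}\quad c_\mu=\frac{\Gamma(\mu+1)}{\Gamma(\frac12)\Gamma(\mu+\frac12)}.$$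
   Context: Here $n$ is a nonnegative integer (the polynomial degree). For $\lambda>-\frac12$, $w_\lambda(t)=(1-t^2)^{\lambda-1/2}$ for $-1<t<1$, and $C_n^\lambda$ is the Gegenbauer polynomial of degree $n$, i.e. the orthogonal polynomial of degree $n$ with respect to $w_\lambda$ normalized by $C_n^\lambda(1)=\binom{n+2\lambda-1}{n}$. With $c_\lambda$ the normalization constant of $w_\lambda$ (so that $c_\lambda\int_{-1}^1 w_\lambda(t)\,dt=1$), let $\widetilde C_n^\lambda$ be the $n$-th orthonormal polynomial with respect to $c_\lambda w_\lambda(t)\,dt$ on $[-1,1]$, that is, $\widetilde C_n^\lambda=C_n^\lambda/\sqrt{h_n^\lambda}$ with $h_n^\lambda=\frac{\lambda}{n+\lambda}C_n^\lambda(1)$. Then $Z_n^\lambda(t)=\widetilde C_n^\lambda(1)\,\widetilde C_n^\lambda(t)=\frac{n+\lambda}{\lambda}C_n^\lambda(t)$. The generating relations are, for $0\le r<1$, $\frac{1}{(1-2rt+r^2)^\lambda}=\sum_{n=0}^\infty C_n^\lambda(t)r^n$ and $\frac{1-r^2}{(1-2rt+r^2)^{\lambda+1}}=\sum_{n=0}^\infty Z_n^\lambda(t)r^n$.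
   Formalization: The first identity (for C_n^λ) is stated only for λ>0, since for -1/2<λ≤0 the inner integral with s^{λ-1} diverges at s=0 (e.g. n=0) or σ_{λ,μ} is undefined; the identity for Z_n^λ keeps the full range λ>-1/2. *)

theory Defs
  imports "HOL-Analysis.Analysis" "HOL-Computational_Algebra.Polynomial"
begin

definition geg_weight :: "real \<Rightarrow> real \<Rightarrow> real" where
  "geg_weight lam t = (1 - t\<^sup>2) powr (lam - 1/2)"

definition geg_const :: "real \<Rightarrow> real" where
  "geg_const lam = 1 / (LBINT t:{-1<..<1}. geg_weight lam t)"

definition geg_orthogonal :: "real \<Rightarrow> nat \<Rightarrow> real poly \<Rightarrow> bool" where
  "geg_orthogonal lam n p \<longleftrightarrow>
     degree p = n \<and>
     (\<forall>q. degree q < n \<longrightarrow> (LBINT t:{-1<..<1}. poly p t * poly q t * geg_weight lam t) = 0)"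

text \<open>
  For \<open>lam > - 1/2\<close> the polynomial below exists and is unique, except when \<open>lam = 0\<close> and
  \<open>n \<ge> 1\<close>: there the prescribed value at 1 is 0, but an orthogonal polynomial of exact degree
  \<open>n\<close> does not vanish at 1, so \<open>gegenbauer 0 n\<close> is unspecified.
\<close>

definition gegenbauer :: "real \<Rightarrow> nat \<Rightarrow> real poly" where
  "gegenbauer lam n =
     (THE p. geg_orthogonal lam n p \<and> poly p 1 = (real n + 2 * lam - 1) gchoose n)"

text \<open>
  The orthonormal polynomials exist for all \<open>lam > - 1/2\<close>, including \<open>lam = 0\<close>. They are
  determined up to sign; a positive leading coefficient is chosen here. For \<open>lam < 0\<close> and
  \<open>n \<ge> 1\<close> this is the opposite of the sign of \<open>gegenbauer lam n\<close>, whose value at 1 is then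
  negative, but the sign cancels in \<open>geg_Z\<close>.
\<close>

definition geg_orthonormal :: "real \<Rightarrow> nat \<Rightarrow> real poly" where
  "geg_orthonormal lam n =
     (THE p. geg_orthogonal lam n p \<and>
        geg_const lam * (LBINT t:{-1<..<1}. (poly p t)\<^sup>2 * geg_weight lam t) = 1 \<and>
        lead_coeff p > 0)"

text \<open>
  For \<open>lam \<noteq> 0\<close> this equals \<open>(n + lam) / lam\<close> times the value of \<open>gegenbauer lam n\<close> at \<open>t\<close>.
  The form used here also makes sense at \<open>lam = 0\<close>, where it is twice the Chebyshev polynomial
  of degree \<open>n\<close> if \<open>n \<ge> 1\<close>, and 1 if \<open>n = 0\<close>.
\<close>

definition geg_Z :: "real \<Rightarrow> nat \<Rightarrow> real \<Rightarrow> real" where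
  "geg_Z lam n t = poly (geg_orthonormal lam n) 1 * poly (geg_orthonormal lam n) t"

definition geg_sigma :: "real \<Rightarrow> real \<Rightarrow> real" where
  "geg_sigma lam mu = Gamma (lam + mu) / (Gamma lam * Gamma mu)"

end

theory Submission imports Defs begin

text \<open>
  Write $t = sx + (1-s)y$. The quadratic $2rt - r^2$ of the generating function
  $(1-2rt+r^2)^{-\nu} = \sum_m \frac{(\nu)_m}{m!}(2rt-r^2)^m$ is affine in $t$, hence equals
  $sX + (1-s)Y$ with $X = 2rx-r^2$ and $Y = 2ry-r^2$. The Beta integral
  $\int_0^1 s^{\lambda+j-1}(1-s)^{\mu+i-1}\,ds = B(\lambda,\mu)\,
  \frac{(\lambda)_j(\mu)_i}{(\lambda+\mu)_{j+i}}$ turns the binomial expansion of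
  $\frac{(\lambda+\mu)_m}{m!}(sX+(1-s)Y)^m$ into
  $B(\lambda,\mu)\sum_{j+i=m} \frac{(\lambda)_j}{j!}X^j\,\frac{(\mu)_i}{i!}Y^i$. So the Beta average of
  the generating function with parameter $\lambda+\mu$ is, up to the factor $B(\lambda,\mu)$, the
  product of the generating functions with parameters $\lambda$ at $x$ and $\mu$ at $y$; this is an
  identity of formal power series in $r$, and its coefficients are finite sums
  (\<open>gegC_beta_LBINT\<close>):
  \[ \int_0^1 C_n^{\lambda+\mu}(sx+(1-s)y)\,s^{\lambda-1}(1-s)^{\mu-1}\,ds
     = B(\lambda,\mu)\sum_{k\le n} C_k^\lambda(x)\,C_{n-k}^\mu(y). \]
  Integrating in $y$ against $w_\mu$ leaves only the term $k = n$, because $C_i^\mu$ with $i \ge 1$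
  is orthogonal to the constants (\<open>geg_int_gegC_convolution\<close>). Since
  $\sigma_{\lambda,\mu}B(\lambda,\mu) = 1$, this is the first formula. The second one is the first one
  with $\lambda+1$ for $\lambda$, because $Z_n^\lambda = C_n^{\lambda+1} - C_{n-2}^{\lambda+1}$
  (\<open>gegZ_eq_gegC_diff\<close>).

  The argument works with explicit coefficients, so these have to be identified with the
  polynomials characterized by orthogonality. They satisfy the Gegenbauer differential equation
  (\<open>geg_op_gegZ\<close>), whose operator is symmetric for $w_\lambda$; symmetry and distinct
  eigenvalues give orthogonality (\<open>geg_op_eigenvector_orthogonal\<close>), which determines a polynomial
  up to a scalar (\<open>geg_orthogonal_unique\<close>). For $Z_n^\lambda$ the scalar is fixed by the norm
  identity $c_\lambda\int (Z_n^\lambda)^2 w_\lambda = Z_n^\lambda(1)$ (\<open>geg_int_gegZ_square\<close>).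
  All of this is done for $Z_n^\lambda$, where $\lambda = 0$ is not exceptional, and carried over to
  $C_n^\lambda$ by $(n+\lambda)\,C_n^\lambda = \lambda\,Z_n^\lambda$.
\<close>

section \<open>Beta integrals and the total mass of the weight\<close>

lemma beta_weight_integral:
  fixes a b :: real
  assumes "a > 0" "b > 0"
  shows beta_weight_integrable:
      "set_integrable lborel {0<..<1} (\<lambda>s. s powr (a - 1) * (1 - s) powr (b - 1))"
    and beta_weight_LBINT:
      "(LBINT s:{0<..<1}. s powr (a - 1) * (1 - s) powr (b - 1)) = Beta a b"
proof -
  show *: "set_integrable lborel {0<..<1} (\<lambda>s. s powr (a - 1) * (1 - s) powr (b - 1))"
    by (rule set_integrable_subset[OF integrable_Beta[OF assms]]) auto
  have "((\<lambda>s. s powr (a - 1) * (1 - s) powr (b - 1)) has_integral Beta a b) {0<..<1}"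
    using has_integral_Beta_real[OF assms] by (simp add: has_integral_Icc_iff_Ioo)
  then show "(LBINT s:{0<..<1}. s powr (a - 1) * (1 - s) powr (b - 1)) = Beta a b"
    using set_borel_integral_eq_integral(2)[OF *] by (simp add: integral_unique)
qed

lemma Gamma_legendre_duplication_real:
  fixes a :: real
  assumes "a > 0"
  shows "Gamma a * Gamma (a + 1/2) = 2 powr (1 - 2 * a) * sqrt pi * Gamma (2 * a)"
proof -
  have notin: "complex_of_real b \<notin> \<int>\<^sub>\<le>\<^sub>0" if "b > 0" for b
    using that nonpos_Ints_nonpos[of b] by (auto simp: of_real_in_nonpos_Ints_iff)
  have half: "complex_of_real a + 1/2 = complex_of_real (a + 1/2)"
    and double: "2 * complex_of_real a = complex_of_real (2 * a)"
    by simp_all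
  have expo: "exp ((1 - complex_of_real (2 * a)) * complex_of_real (ln 2)) =
      complex_of_real (exp ((1 - 2 * a) * ln 2))"
    by (simp flip: exp_of_real)
  have "a + 1/2 > 0" using assms by simp
  from Gamma_legendre_duplication[of "complex_of_real a", unfolded half, OF notin[OF assms] notin[OF this]]
  have "complex_of_real (Gamma a * Gamma (a + 1/2)) =
        complex_of_real (exp ((1 - 2 * a) * ln 2) * sqrt pi * Gamma (2 * a))"
    unfolding double expo Gamma_complex_of_real unfolding of_real_mult .
  then have "Gamma a * Gamma (a + 1/2) = exp ((1 - 2 * a) * ln 2) * sqrt pi * Gamma (2 * a)"
    unfolding of_real_eq_iff .
  then show ?thesis
    by (simp add: powr_def)
qed

text \<open>
  The substitution $t = 2u - 1$ turns $1 - t^2$ into $4u(1-u)$ and the integral into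
  $B(\lambda+\frac12,\lambda+\frac12)$; Legendre duplication brings the result to the form that has
  $\Gamma(\frac12)$ as a factor.
\<close>

lemma geg_weight_integral:
  assumes "lam > -1/2"
  shows geg_weight_integrable: "set_integrable lborel {-1<..<1} (geg_weight lam)"
    and geg_weight_LBINT: "(LBINT t:{-1<..<1}. geg_weight lam t) =
      Gamma (1/2) * Gamma (lam + 1/2) / Gamma (lam + 1)"
proof -
  define a where "a = lam + 1/2"
  have a: "a > 0" using assms by (simp add: a_def)
  have a_half: "a + 1/2 = lam + 1" by (simp add: a_def)
  define f where "f = (\<lambda>u::real. indicator {0<..<1} u *\<^sub>R (u powr (a - 1) * (1 - u) powr (a - 1)))"
  have f_int: "integrable lborel f"
    using beta_weight_integrable[OF a a] by (simp add: f_def set_integrable_def)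
  have f_affine: "f (1/2 + 1/2 * t) = (1/4) powr (a - 1) * (indicator {-1<..<1} t *\<^sub>R geg_weight lam t)" for t
  proof (cases "t \<in> {-1<..<1}")
    case True
    then have "(1/2 + 1/2*t) powr (a-1) * (1 - (1/2 + 1/2*t)) powr (a-1) =
      ((1/2 + 1/2*t) * (1 - (1/2 + 1/2*t))) powr (a-1)"
      by (intro powr_mult[symmetric])
    also have "(1/2 + 1/2*t) * (1 - (1/2 + 1/2*t)) = (1/4) * (1 - t\<^sup>2)"
      by (simp add: field_simps power2_eq_square)
    also have "\<dots> powr (a-1) = (1/4) powr (a - 1) * (1 - t\<^sup>2) powr (a - 1)"
      by (rule powr_mult)
    finally show ?thesis using True
      by (simp add: f_def geg_weight_def a_def indicator_def)
  qed (auto simp: f_def indicator_def)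
  have "integrable lborel (\<lambda>t. f (1/2 + 1/2 * t))"
    by (rule lborel_integrable_real_affine[OF f_int]) simp
  then show "set_integrable lborel {-1<..<1} (geg_weight lam)"
    unfolding f_affine set_integrable_def by simp
  have "Beta a a = (\<integral>u. f u \<partial>lborel)"
    using beta_weight_LBINT[OF a a] by (simp add: f_def set_lebesgue_integral_def)
  also have "\<dots> = \<bar>1/2\<bar> *\<^sub>R (\<integral>t. f (1/2 + 1/2 * t) \<partial>lborel)"
    by (rule lborel_integral_real_affine) simp
  also have "\<dots> = 1/2 * (1/4) powr (a - 1) * (LBINT t:{-1<..<1}. geg_weight lam t)"
    unfolding f_affine set_lebesgue_integral_def by simp
  finally have 1: "(LBINT t:{-1<..<1}. geg_weight lam t) = 2 * Beta a a / (1/4) powr (a - 1)"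
    by (simp add: field_simps)
  have 2: "(1/4::real) powr (a - 1) = 2 powr (2 - 2 * a)"
  proof -
    have "(1/4::real) = 2 powr (-2)" by (simp add: powr_minus)
    then have "(1/4::real) powr (a - 1) = (2 powr (-2)) powr (a - 1)" by (rule arg_cong)
    also have "\<dots> = 2 powr (2 - 2 * a)" by (simp only: powr_powr) (simp add: algebra_simps)
    finally show ?thesis .
  qed
  have 3: "(2::real) powr (2 - 2 * a) = 2 * 2 powr (1 - 2 * a)"
    using powr_add[of 2 1 "1 - 2*a"] by simp
  have quotient: "2 * (g * g / g2) / (2 * q) = r * g / h"
    if "g * h = q * r * g2" "g2 > 0" "h > 0" "q > 0" for g h q r g2 :: real
  proof -
    have "2 * (g * g / g2) / (2 * q) = g * (g * h) / (g2 * q * h)" using that(2-) by simp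
    also have "\<dots> = r * g / h" unfolding that(1) using that(2-) by simp
    finally show ?thesis .
  qed
  have "2 * Beta a a / (1/4) powr (a - 1) = sqrt pi * Gamma a / Gamma (a + 1/2)"
    unfolding 2 3 Beta_def mult_2[symmetric]
    by (rule quotient[OF Gamma_legendre_duplication_real[OF a]]) (use a in \<open>auto intro!: Gamma_real_pos\<close>)
  then show "(LBINT t:{-1<..<1}. geg_weight lam t) = Gamma (1/2) * Gamma (lam + 1/2) / Gamma (lam + 1)"
    unfolding 1 Gamma_one_half_real a_half unfolding a_def .
qed

section \<open>Integration of polynomials against the weight\<close>

text \<open>
  As a functional on polynomials the integral is linear without integrability side conditions,
  so that identities between integrals reduce to identities between polynomials.
\<close>

definition geg_int :: "real \<Rightarrow> real poly \<Rightarrow> real" where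
  "geg_int lam p = (LBINT t:{-1<..<1}. poly p t * geg_weight lam t)"

lemma poly_geg_weight_integrable:
  assumes "lam > -1/2"
  shows "set_integrable lborel {-1<..<1} (\<lambda>t. poly p t * geg_weight lam t)"
proof -
  have "bounded (poly p ` {-1..1})"
    by (intro compact_imp_bounded compact_continuous_image continuous_intros) auto
  then obtain B where "\<forall>y \<in> poly p ` {-1..1}. norm y \<le> B"
    unfolding bounded_iff by blast
  then have B: "\<bar>poly p t\<bar> \<le> B" if "t \<in> {-1..1}" for t
    using that by simp
  have meas: "(\<lambda>t. geg_weight lam t) \<in> borel_measurable lborel"
    unfolding geg_weight_def by measurable
  have "(\<lambda>t. poly p t) \<in> borel_measurable lborel"
    by (auto intro!: borel_measurable_continuous_onI continuous_intros)
  with meas have meas': "set_borel_measurable lborel {-1<..<1} (\<lambda>t. poly p t * geg_weight lam t)"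
    unfolding set_borel_measurable_def by measurable
  have int: "set_integrable lborel {-1<..<1} (\<lambda>t. B * geg_weight lam t)"
    using geg_weight_integrable[OF assms] by simp
  have "norm (poly p t * geg_weight lam t) \<le> norm (B * geg_weight lam t)" if "t \<in> {-1<..<1}" for t
    unfolding norm_mult by (intro mult_right_mono) (use B[of t] that in auto)
  then have "AE t in lborel. t \<in> {-1<..<1} \<longrightarrow>
      norm (poly p t * geg_weight lam t) \<le> norm (B * geg_weight lam t)"
    by (intro always_eventually) blast
  then show ?thesis
    by (rule set_integrable_bound[OF int meas'])
qed

context
  fixes lam :: real
  assumes lam: "lam > -1/2"
begin

lemma geg_int_0 [simp]: "geg_int lam 0 = 0"
  by (simp add: geg_int_def)

lemma geg_int_add: "geg_int lam (p + q) = geg_int lam p + geg_int lam q"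
  using set_integral_add(2)[OF poly_geg_weight_integrable[OF lam, of p]
      poly_geg_weight_integrable[OF lam, of q]]
  by (simp add: geg_int_def algebra_simps)

lemma geg_int_smult: "geg_int lam (smult c p) = c * geg_int lam p"
  by (simp add: geg_int_def mult.assoc)

lemma geg_int_diff: "geg_int lam (p - q) = geg_int lam p - geg_int lam q"
  using geg_int_add[of p "smult (-1) q"] by (simp only: geg_int_smult) simp

lemma geg_int_sum: "geg_int lam (\<Sum>i\<in>A. f i) = (\<Sum>i\<in>A. geg_int lam (f i))"
  by (induction A rule: infinite_finite_induct) (simp_all add: geg_int_add)

lemma geg_int_1: "geg_int lam 1 = Gamma (1/2) * Gamma (lam + 1/2) / Gamma (lam + 1)"
  using geg_weight_LBINT[OF lam] by (simp add: geg_int_def)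

lemma geg_int_1_pos: "geg_int lam 1 > 0"
  unfolding geg_int_1 using lam by (intro divide_pos_pos mult_pos_pos Gamma_real_pos) auto

lemma geg_const_eq: "geg_const lam = 1 / geg_int lam 1"
  by (simp add: geg_const_def geg_int_def)

lemma geg_int_square_pos:
  assumes "p \<noteq> 0"
  shows "geg_int lam (p * p) > 0"
proof -
  let ?f = "\<lambda>t. indicator {-1<..<1} t *\<^sub>R (poly (p * p) t * geg_weight lam t)"
  have int: "integrable lborel ?f"
    using poly_geg_weight_integrable[OF lam, of "p * p"] by (simp add: set_integrable_def)
  have nonneg: "?f t \<ge> 0" for t by (simp add: geg_weight_def)
  have "integral\<^sup>L lborel ?f \<noteq> 0"
  proof
    assume "integral\<^sup>L lborel ?f = 0"
    then have "AE t in lborel. ?f t = 0"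
      using integral_nonneg_eq_0_iff_AE[OF int] nonneg by simp
    then have "AE t in lborel. t \<in> {-1<..<1} \<longrightarrow> t \<in> {t. poly p t = 0}"
    proof eventually_elim
      case (elim t)
      have "geg_weight lam t \<noteq> 0" if "t \<in> {-1<..<1}"
        using that by (auto simp: geg_weight_def power2_eq_1_iff)
      with elim show ?case by auto
    qed
    then have ae: "AE t in lborel. t \<notin> {-1<..<1} - {t. poly p t = 0}"
      by eventually_elim auto
    have fin: "finite {t. poly p t = 0}" using assms by (rule poly_roots_finite)
    then have m: "{-1<..<1} - {t. poly p t = 0} \<in> sets lborel"
      by (simp add: borel_closed finite_imp_closed sets.Diff)
    have "emeasure lborel ({-1<..<1} - {t. poly p t = 0}) = 0"
      using ae m by (subst (asm) AE_iff_measurable[where N = "{-1<..<1} - {t. poly p t = 0}"]) auto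
    moreover have "emeasure lborel ({-1<..<1} - {t. poly p t = 0}) = emeasure lborel {-1<..<(1::real)}"
      by (rule emeasure_Diff_null_set) (use fin in \<open>auto simp: finite_imp_null_set_lborel\<close>)
    ultimately show False by simp
  qed
  moreover have "integral\<^sup>L lborel ?f \<ge> 0"
    by (rule integral_nonneg_AE) (use nonneg in auto)
  ultimately show ?thesis
    by (simp add: geg_int_def set_lebesgue_integral_def)
qed

text \<open>
  The integrand is the derivative of $p(t)\,(1-t^2)^{\lambda+1/2}$, which vanishes at both ends
  because $\lambda + \frac12 > 0$.
\<close>

lemma geg_int_by_parts:
  "geg_int lam ([:1, 0, -1:] * pderiv p - smult (2 * lam + 1) ([:0, 1:] * p)) = 0"
proof -
  define F where "F = (\<lambda>t. poly p t * (1 - t\<^sup>2) powr (lam + 1/2))"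
  let ?q = "[:1, 0, -1:] * pderiv p - smult (2 * lam + 1) ([:0, 1:] * p)"
  have "continuous_on {-1..1} F"
    unfolding F_def using lam
    by (intro continuous_intros continuous_on_powr') (auto simp: abs_square_le_1 abs_le_iff)
  moreover have "(F has_vector_derivative (poly ?q t * geg_weight lam t)) (at t)"
    if "t \<in> {-1<..<1}" for t
  proof -
    have pos: "1 - t\<^sup>2 > 0" using that by (simp add: abs_square_less_1 abs_less_iff)
    have "((\<lambda>t. 1 - t\<^sup>2) has_real_derivative - 2 * t) (at t)"
      by (auto intro!: derivative_eq_intros)
    from DERIV_mult[OF poly_DERIV[of p t] DERIV_fun_powr[OF this pos, of "lam + 1/2"]]
    have "(F has_real_derivative
       (poly (pderiv p) t * (1 - t\<^sup>2) powr (lam + 1/2) +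
        (lam + 1/2) * (1 - t\<^sup>2) powr (lam + 1/2 - 1) * (- 2 * t) * poly p t)) (at t)"
      by (simp add: F_def)
    moreover have "(1 - t\<^sup>2) powr (lam + 1/2) = (1 - t\<^sup>2) * geg_weight lam t"
      using pos powr_add[of "1 - t\<^sup>2" 1 "lam - 1/2"] by (simp add: geg_weight_def add.commute)
    moreover have "(1 - t\<^sup>2) powr (lam + 1/2 - 1) = geg_weight lam t"
      by (simp add: geg_weight_def)
    ultimately have "(F has_real_derivative
       (poly (pderiv p) t * ((1 - t\<^sup>2) * geg_weight lam t) +
        (lam + 1/2) * geg_weight lam t * (- 2 * t) * poly p t)) (at t)"
      by (simp only:)
    also have "poly (pderiv p) t * ((1 - t\<^sup>2) * geg_weight lam t) +
        (lam + 1/2) * geg_weight lam t * (- 2 * t) * poly p t = poly ?q t * geg_weight lam t"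
      by (simp add: algebra_simps power2_eq_square)
    finally show ?thesis
      by (simp only: has_real_derivative_iff_has_vector_derivative)
  qed
  ultimately have "((\<lambda>t. poly ?q t * geg_weight lam t) has_integral (F 1 - F (-1))) {-1..1}"
    by (intro fundamental_theorem_of_calculus_interior) auto
  then have "((\<lambda>t. poly ?q t * geg_weight lam t) has_integral 0) {-1<..<1}"
    by (simp add: F_def has_integral_Icc_iff_Ioo)
  then show ?thesis
    using set_borel_integral_eq_integral(2)[OF poly_geg_weight_integrable[OF lam, of ?q]]
    by (simp add: geg_int_def integral_unique)
qed

lemma geg_int_Suc_lam: "geg_int (lam + 1) p = geg_int lam ([:1, 0, -1:] * p)"
  unfolding geg_int_def
proof (rule set_lebesgue_integral_cong)
  show "\<forall>t. t \<in> {-1<..<1} \<longrightarrow> poly p t * geg_weight (lam + 1) t =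
      poly ([:1, 0, -1:] * p) t * geg_weight lam t"
  proof (intro allI impI)
    fix t :: real assume "t \<in> {-1<..<1}"
    then have pos: "1 - t\<^sup>2 > 0" by (simp add: abs_square_less_1 abs_less_iff)
    have "geg_weight (lam + 1) t = (1 - t\<^sup>2) * geg_weight lam t"
      using pos powr_add[of "1 - t\<^sup>2" 1 "lam - 1/2"] by (simp add: geg_weight_def)
    then show "poly p t * geg_weight (lam + 1) t =
      poly ([:1, 0, -1:] * p) t * geg_weight lam t"
      by (simp only:) (simp add: algebra_simps power2_eq_square)
  qed
qed auto

text \<open>
  The ratio of the masses of consecutive weights, needed for the norms, is integration by parts
  with $p = t$.
\<close>

lemma geg_int_1_Suc_lam: "(2 * lam + 2) * geg_int (lam + 1) 1 = (2 * lam + 1) * geg_int lam 1"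
proof -
  have "[:1, 0, -1:] * pderiv [:0, 1:] - smult (2 * lam + 1) ([:0, 1:] * [:0, 1:]) =
     smult (2 * lam + 2) ([:1, 0, -1:] * 1) - smult (2 * lam + 1) 1"
    by (simp add: pderiv_pCons one_pCons)
  then have "geg_int lam (smult (2 * lam + 2) ([:1, 0, -1:] * 1) - smult (2 * lam + 1) 1) = 0"
    using geg_int_by_parts[of "[:0, 1:]"] by (simp only:)
  then show ?thesis
    unfolding geg_int_diff geg_int_smult geg_int_Suc_lam by simp
qed

end

section \<open>Explicit Gegenbauer polynomials\<close>

text \<open>
  Gegenbauer polynomials have the parity of their degree, so the coefficient of $t^{n-2k}$ is
  indexed by $k$. Shifting the degree by two is then a shift of $k$ by one.
\<close>

definition parity_poly :: "nat \<Rightarrow> (nat \<Rightarrow> real) \<Rightarrow> real poly" where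
  "parity_poly n c = (\<Sum>k\<le>n div 2. monom (c k) (n - 2 * k))"

lemma coeff_parity_poly:
  "coeff (parity_poly n c) m = (if m \<le> n \<and> even (n - m) then c ((n - m) div 2) else 0)"
proof -
  have "coeff (parity_poly n c) m = (\<Sum>k\<le>n div 2. if n - 2 * k = m then c k else 0)"
    by (simp add: parity_poly_def coeff_sum)
  also have "\<dots> = (\<Sum>k\<le>n div 2. if k = (n - m) div 2 then (if m \<le> n \<and> even (n - m) then c k else 0) else 0)"
  proof (intro sum.cong refl)
    fix k assume "k \<in> {..n div 2}"
    then have "n - 2 * k = m \<longleftrightarrow> k = (n - m) div 2 \<and> m \<le> n \<and> even (n - m)"
      by (auto; presburger)
    then show "(if n - 2 * k = m then c k else 0) =
        (if k = (n - m) div 2 then (if m \<le> n \<and> even (n - m) then c k else 0) else 0)"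
      by simp
  qed
  also have "\<dots> = (if m \<le> n \<and> even (n - m) then c ((n - m) div 2) else 0)"
    by (subst sum.delta) (auto simp: div_le_mono)
  finally show ?thesis .
qed

text \<open>
  The Gegenbauer operator $(1-t^2)\,p'' - (2\lambda+1)\,t\,p'$.
\<close>

definition geg_op :: "real \<Rightarrow> real poly \<Rightarrow> real poly" where
  "geg_op lam p = [:1, 0, -1:] * pderiv (pderiv p) - smult (2 * lam + 1) ([:0, 1:] * pderiv p)"

lemma coeff_geg_op:
  "coeff (geg_op lam p) m =
    real (m + 2) * real (m + 1) * coeff p (m + 2) - real m * (real m + 2 * lam) * coeff p m"
proof -
  consider "m = 0" | "m = 1" | j where "m = j + 2"
    by (metis One_nat_def Suc_1 add_2_eq_Suc' not0_implies_Suc)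
  then show ?thesis
    by cases (simp_all add: geg_op_def coeff_pderiv algebra_simps numeral_eq_Suc)
qed

text \<open>
  Comparing coefficients of $t^{n-2k-2}$, the eigenvalue equation for $-n(n+2\lambda)$ becomes a
  two-term recursion, since $n(n+2\lambda) - m(m+2\lambda) = (n-m)(n+m+2\lambda)$.
\<close>

lemma geg_op_parity_poly:
  assumes "\<And>k. 2 * k + 2 \<le> n \<Longrightarrow>
    4 * (real k + 1) * (real n - real k - 1 + lam) * c (Suc k) =
      - (real n - 2 * real k) * (real n - 2 * real k - 1) * c k"
  shows "geg_op lam (parity_poly n c) = smult (- real n * (real n + 2 * lam)) (parity_poly n c)"
proof (rule poly_eqI)
  fix m
  consider "m > n \<or> odd (n - m)" | "m = n" | k where "n = m + 2 * Suc k"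
  proof -
    assume *: "m > n \<or> odd (n - m) \<Longrightarrow> thesis" "m = n \<Longrightarrow> thesis" "\<And>k. n = m + 2 * Suc k \<Longrightarrow> thesis"
    show thesis
    proof (cases "m < n \<and> even (n - m)")
      case True
      then obtain j where "n - m = 2 * j" using dvdE by blast
      moreover from this True obtain k where "j = Suc k" by (cases j) auto
      ultimately show ?thesis using True by (intro *(3)[of k]) simp
    qed (use * in \<open>auto simp: not_less le_less\<close>)
  qed
  then show "coeff (geg_op lam (parity_poly n c)) m =
      coeff (smult (- real n * (real n + 2 * lam)) (parity_poly n c)) m"
  proof cases
    case 1
    then have "\<not> (m \<le> n \<and> even (n - m))" "\<not> (m + 2 \<le> n \<and> even (n - (m + 2)))"
      by auto
    then show ?thesis by (simp only: coeff_geg_op coeff_parity_poly coeff_smult) simp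
  next
    case 2
    then show ?thesis by (simp add: coeff_geg_op coeff_parity_poly)
  next
    case 3
    have c: "coeff (parity_poly n c) m = c (Suc k)" "coeff (parity_poly n c) (m + 2) = c k"
      by (simp_all add: 3 coeff_parity_poly)
    have "2 * k + 2 \<le> n" "real n = real m + 2 * (real k + 1)" using 3 by simp_all
    with assms[of k] show ?thesis
      unfolding coeff_geg_op coeff_smult c by (simp add: algebra_simps)
  qed
qed

text \<open>
  The coefficients of $r^n$ in $(1-2rt+r^2)^{-\lambda}$.
\<close>

definition gegC :: "real \<Rightarrow> nat \<Rightarrow> real poly" where
  "gegC lam n = parity_poly n (\<lambda>k. (-1) ^ k * pochhammer lam (n - k) * 2 ^ (n - 2 * k) /
     (fact k * fact (n - 2 * k)))"

text \<open>
  Formally this is $\frac{n+\lambda}{\lambda}$ times the polynomial above, with the factor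
  $\lambda$ of $(\lambda)_{n-k} = \lambda\,(\lambda+1)_{n-k-1}$ cancelled so that $\lambda = 0$ is
  covered. For $n = 0$ the Pochhammer symbol has no such factor, whence the separate case.
\<close>

definition gegZ :: "real \<Rightarrow> nat \<Rightarrow> real poly" where
  "gegZ lam n = (if n = 0 then 1 else parity_poly n (\<lambda>k. (-1) ^ k * (real n + lam) *
     pochhammer (lam + 1) (n - 1 - k) * 2 ^ (n - 2 * k) / (fact k * fact (n - 2 * k))))"

lemma gegC_0 [simp]: "gegC lam 0 = 1"
  by (simp add: gegC_def parity_poly_def)

lemma gegZ_0 [simp]: "gegZ lam 0 = 1"
  by (simp add: gegZ_def)

lemma smult_gegC_eq_gegZ: "smult (real n + lam) (gegC lam n) = smult lam (gegZ lam n)"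
proof (cases n)
  case (Suc N)
  show ?thesis
  proof (rule poly_eqI)
    fix m
    have "pochhammer lam (n - k) = lam * pochhammer (lam + 1) (n - 1 - k)" if "k \<le> N" for k
      using that pochhammer_rec[of lam "N - k"] by (simp add: Suc Suc_diff_le)
    moreover have "(n - m) div 2 \<le> N" using Suc by simp
    ultimately have p: "pochhammer lam (n - (n - m) div 2) =
        lam * pochhammer (lam + 1) (n - 1 - (n - m) div 2)" by blast
    have "n \<noteq> 0" using Suc by simp
    then show "coeff (smult (real n + lam) (gegC lam n)) m = coeff (smult lam (gegZ lam n)) m"
      unfolding coeff_smult gegC_def gegZ_def if_not_P[OF \<open>n \<noteq> 0\<close>] coeff_parity_poly p
      by (cases "m \<le> n \<and> even (n - m)") (simp_all only: if_True if_False, simp_all)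
  qed
qed simp

text \<open>
  In terms of generating functions this is the factor $1 - r^2$ in
  $(1-r^2)(1-2rt+r^2)^{-\lambda-1} = \sum_n Z_n^\lambda(t)\,r^n$. On coefficients it amounts to
  $(\lambda + n - k) + k = n + \lambda$.
\<close>

lemma gegZ_eq_gegC_diff:
  "gegZ lam n = gegC (lam + 1) n - (if n < 2 then 0 else gegC (lam + 1) (n - 2))"
proof -
  consider "n = 0" | "n = 1" | "n \<ge> 2" by linarith
  then show ?thesis
  proof cases
    case 3
    show ?thesis
    proof (rule poly_eqI)
      fix m
      show "coeff (gegZ lam n) m =
          coeff (gegC (lam + 1) n - (if n < 2 then 0 else gegC (lam + 1) (n - 2))) m"
      proof (cases "m \<le> n \<and> even (n - m)")
        case False
        then have "\<not> (m \<le> n - 2 \<and> even (n - 2 - m))" using 3 by (auto; presburger)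
        moreover have "\<not> n < 2" "n \<noteq> 0" using 3 by simp_all
        ultimately show ?thesis
          using False by (simp only: coeff_diff gegC_def gegZ_def coeff_parity_poly if_False simp_thms)
      next
        case True
        then obtain k where k: "n = m + 2 * k" by (metis evenE le_add_diff_inverse)
        show ?thesis
        proof (cases k)
          case 0
          then obtain N where "n = Suc N" "m = Suc N" using 3 k by (cases n) auto
          then show ?thesis using 3 k 0
            by (simp add: gegC_def gegZ_def coeff_parity_poly pochhammer_rec' algebra_simps)
        next
          case (Suc j)
          have c1: "coeff (gegC (lam + 1) n) m = (-1) ^ k * pochhammer (lam + 1) (m + k) * 2 ^ m / (fact k * fact m)"
            using k by (simp add: gegC_def coeff_parity_poly add.commute)
          have c2: "coeff (gegC (lam + 1) (n - 2)) m =
              (-1) ^ j * pochhammer (lam + 1) (m + j) * 2 ^ m / (fact j * fact m)"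
            using k Suc by (simp add: gegC_def coeff_parity_poly add.commute)
          have c3: "coeff (gegZ lam n) m = (-1) ^ k * (real n + lam) *
              pochhammer (lam + 1) (m + j) * 2 ^ m / (fact k * fact m)"
            using k Suc by (simp add: gegZ_def coeff_parity_poly add.commute)
          have p: "pochhammer (lam + 1) (m + k) = (real m + real j + lam + 1) * pochhammer (lam + 1) (m + j)"
            using Suc by (simp add: pochhammer_rec' algebra_simps)
          define a where "a = (-1) ^ j * pochhammer (lam + 1) (m + j) * 2 ^ m / (fact j * fact m)"
          have f: "fact k = (real j + 1) * fact j" "(-1) ^ k = - ((-1) ^ j :: real)"
            by (simp_all add: Suc)
          \<comment> \<open>Both coefficients are rational multiples of \<open>a\<close>; the powers and factorials drop out.\<close>
          have scale: "- s * (b * p) * t / ((real j + 1) * u * v) = - b * (s * p * t / (u * v)) / (real j + 1)"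
            for b p s t u v :: real by (simp add: mult_ac)
          have C: "coeff (gegC (lam + 1) n) m = - (real m + real j + lam + 1) * a / (real j + 1)"
            unfolding c1 p f a_def scale ..
          have Z: "coeff (gegZ lam n) m = - (real n + lam) * a / (real j + 1)"
            unfolding c3 f a_def scale[symmetric] by simp
          have "\<not> n < 2" "real n = real m + 2 * (real j + 1)" using 3 k Suc by simp_all
          then show ?thesis
            by (simp only: if_False coeff_diff C Z c2 a_def[symmetric]) (simp add: field_simps)
        qed
      qed
    qed
  qed (auto simp: gegC_def gegZ_def parity_poly_def)
qed

lemma coeff_gegZ_Suc: 
  "coeff (gegZ lam (Suc N)) m = (if m \<le> Suc N \<and> even (Suc N - m) then
     (-1) ^ ((Suc N - m) div 2) * (real (Suc N) + lam) * pochhammer (lam + 1) (N - (Suc N - m) div 2) * 2 ^ m /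
     (fact ((Suc N - m) div 2) * fact m) else 0)"
  by (auto simp: gegZ_def coeff_parity_poly)

lemma pderiv_gegZ: "pderiv (gegZ lam (Suc N)) = smult (2 * (lam + 1)) (gegZ (lam + 1) N)"
proof (cases N)
  case 0
  then show ?thesis by (simp add: gegZ_def parity_poly_def pderiv_monom monom_0)
next
  case (Suc M)
  show ?thesis
  proof (rule poly_eqI)
    fix m
    show "coeff (pderiv (gegZ lam (Suc N))) m = coeff (smult (2 * (lam + 1)) (gegZ (lam + 1) N)) m"
    proof (cases "m \<le> N \<and> even (N - m)")
      case True
      then obtain k where k: "N = m + 2 * k" by (metis evenE le_add_diff_inverse)
      have c1: "coeff (gegZ lam (Suc N)) (Suc m) = (-1) ^ k * (real (Suc N) + lam) *
          pochhammer (lam + 1) (N - k) * 2 ^ Suc m / (fact k * fact (Suc m))"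
        using k by (simp add: coeff_gegZ_Suc)
      have c2: "coeff (gegZ (lam + 1) N) m = (-1) ^ k * (real N + (lam + 1)) *
          pochhammer (lam + 1 + 1) (M - k) * 2 ^ m / (fact k * fact m)"
        using k unfolding Suc coeff_gegZ_Suc by simp
      have "N - k = Suc (M - k)" using k Suc by simp
      then have p: "pochhammer (lam + 1) (N - k) = (lam + 1) * pochhammer (lam + 1 + 1) (M - k)"
        by (simp only: pochhammer_rec)
      have f: "fact (Suc m) = real (Suc m) * fact m" by simp
      have r: "real (Suc N) + lam = real N + (lam + 1)" by simp
      have "d * (a * ((lam + 1) * q) * 2 ^ Suc m / (fact k * (d * fact m))) =
          2 * (lam + 1) * (a * q * 2 ^ m / (fact k * fact m))" if "d \<noteq> 0" for a d q :: real
        using that by (simp add: mult_ac)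
      then show ?thesis
        unfolding coeff_pderiv coeff_smult c1 c2 p f r by simp
    next
      case False
      then show ?thesis by (auto simp: coeff_pderiv coeff_gegZ_Suc Suc)
    qed
  qed
qed

lemma geg_op_gegZ: "geg_op lam (gegZ lam n) = smult (- real n * (real n + 2 * lam)) (gegZ lam n)"
proof (cases n)
  case 0
  then show ?thesis by (simp add: geg_op_def)
next
  case (Suc N)
  show ?thesis
    unfolding gegZ_def
  proof (simp only: Suc nat.simps if_False, rule geg_op_parity_poly)
    fix k assume k: "2 * k + 2 \<le> Suc N"
    then obtain m where N: "N = Suc (m + 2 * k)" 
      by (metis Suc_le_mono add_2_eq_Suc' le_iff_add add.commute add_Suc)
    have p: "pochhammer (lam + 1) (Suc N - 1 - k) =
        (real m + real k + 1 + lam) * pochhammer (lam + 1) (m + k)"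
      by (simp add: N pochhammer_rec' algebra_simps)
    have e: "Suc N - 2 * k = Suc (Suc m)" "Suc N - 2 * Suc k = m" "Suc N - 1 - Suc k = m + k"
      by (simp_all add: N)
    show "4 * (real k + 1) * (real (Suc N) - real k - 1 + lam) *
         ((-1) ^ Suc k * (real (Suc N) + lam) * pochhammer (lam + 1) (Suc N - 1 - Suc k) *
          2 ^ (Suc N - 2 * Suc k) / (fact (Suc k) * fact (Suc N - 2 * Suc k))) =
         - (real (Suc N) - 2 * real k) * (real (Suc N) - 2 * real k - 1) *
         ((-1) ^ k * (real (Suc N) + lam) * pochhammer (lam + 1) (Suc N - 1 - k) *
          2 ^ (Suc N - 2 * k) / (fact k * fact (Suc N - 2 * k)))"
      unfolding p unfolding e
    proof -
      define X where "X = (-1) ^ k * (real (Suc N) + lam) * pochhammer (lam + 1) (m + k) * 2 ^ m /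
        (fact k * fact m)"
      have s1: "(-1) ^ Suc k * (real (Suc N) + lam) * pochhammer (lam + 1) (m + k) * 2 ^ m /
          (fact (Suc k) * fact m) = - X / (real k + 1)"
        by (simp add: X_def add.commute)
      have f: "fact (Suc (Suc m)) = ((real m + 2) * (real m + 1)) * fact m"
        by (simp add: algebra_simps)
      have "(-1) ^ k * (real (Suc N) + lam) * (b * pochhammer (lam + 1) (m + k)) *
          2 ^ Suc (Suc m) / (fact k * (d * fact m)) = 4 * b * X / d" for b d
        by (simp add: X_def mult_ac)
      then have s2: "(-1) ^ k * (real (Suc N) + lam) * ((real m + real k + 1 + lam) * pochhammer (lam + 1) (m + k)) *
          2 ^ Suc (Suc m) / (fact k * fact (Suc (Suc m))) =
          4 * (real m + real k + 1 + lam) * X / ((real m + 2) * (real m + 1))"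
        unfolding f .
      have r: "real (Suc N) - real k - 1 + lam = real m + real k + 1 + lam"
        "real (Suc N) - 2 * real k = real m + 2" "real m + 2 - 1 = real m + 1"
        by (simp_all add: N)
      have cancel: "4 * u * v * (- X / u) = - s * t * (4 * v * X / (s * t))"
        if "u > 0" "s > 0" "t > 0" for s t u v :: real
        using that by simp
      show "4 * (real k + 1) * (real (Suc N) - real k - 1 + lam) *
         ((-1) ^ Suc k * (real (Suc N) + lam) * pochhammer (lam + 1) (m + k) *
          2 ^ m / (fact (Suc k) * fact m)) =
         - (real (Suc N) - 2 * real k) * (real (Suc N) - 2 * real k - 1) *
         ((-1) ^ k * (real (Suc N) + lam) * ((real m + real k + 1 + lam) * pochhammer (lam + 1) (m + k)) *
          2 ^ Suc (Suc m) / (fact k * fact (Suc (Suc m))))"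
        unfolding s1 s2 unfolding r by (rule cancel) simp_all
    qed
  qed
qed

lemma gegZ_degree_lead_coeff:
  assumes "lam > -1/2"
  shows degree_gegZ: "degree (gegZ lam n) = n"
    and lead_coeff_gegZ_pos: "lead_coeff (gegZ lam n) > 0"
proof -
  have pos: "coeff (gegZ lam n) n > 0"
    using assms by (cases n) (auto simp: coeff_gegZ_Suc intro!: divide_pos_pos mult_pos_pos pochhammer_pos)
  moreover have "coeff (gegZ lam n) m = 0" if "m > n" for m
    using that by (cases n) (auto simp: coeff_gegZ_Suc)
  ultimately show "degree (gegZ lam n) = n"
    by (intro antisym degree_le le_degree) auto
  with pos show "lead_coeff (gegZ lam n) > 0" by simp
qed

text \<open>
  At $t = 1$ the leading term of the differential equation drops out, so the value of the polynomial
  is determined by the value of its derivative, a polynomial with parameter $\lambda + 1$.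
\<close>

lemma gegZ_at_1_rec:
  "real (Suc N) * (real (Suc N) + 2 * lam) * poly (gegZ lam (Suc N)) 1 =
    (2 * lam + 1) * (2 * (lam + 1)) * poly (gegZ (lam + 1) N) 1"
proof -
  have "poly (geg_op lam (gegZ lam (Suc N))) 1 =
     poly (smult (- real (Suc N) * (real (Suc N) + 2 * lam)) (gegZ lam (Suc N))) 1"
    by (simp only: geg_op_gegZ)
  then show ?thesis
    by (simp add: geg_op_def pderiv_gegZ algebra_simps)
qed

lemma gegZ_at_1:
  assumes "lam > -1/2"
  shows "poly (gegZ lam (Suc N)) 1 = 2 * (real (Suc N) + lam) * pochhammer (2 * lam + 1) N / fact (Suc N)"
  using assms
proof (induction N arbitrary: lam)
  case 0
  then show ?case by (simp add: gegZ_def parity_poly_def poly_monom)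
next
  case (Suc N)
  define n where "n = real (Suc (Suc N))"
  have pos: "n * (n + 2 * lam) > 0" using Suc.prems by (simp add: n_def)
  have fact: "fact (Suc (Suc N)) = n * fact (Suc N)" by (simp add: n_def)
  \<comment> \<open>Two factors are split off at the front of $(2\lambda+1)_{N+2}$, or one at its end.\<close>
  have "2 * (lam + 1) + 1 = 2 * lam + 1 + 1 + 1" by simp
  then have "(2 * lam + 1) * (2 * (lam + 1)) * pochhammer (2 * (lam + 1) + 1) N =
      pochhammer (2 * lam + 1) (Suc (Suc N))"
    by (simp only: pochhammer_rec) (simp add: algebra_simps)
  also have "\<dots> = (n + 2 * lam) * pochhammer (2 * lam + 1) (Suc N)"
    by (simp only: pochhammer_rec'[of _ "Suc N"]) (simp add: n_def algebra_simps)
  finally have poch: "(2 * lam + 1) * (2 * (lam + 1)) * pochhammer (2 * (lam + 1) + 1) N =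
      (n + 2 * lam) * pochhammer (2 * lam + 1) (Suc N)" .
  have IH: "poly (gegZ (lam + 1) (Suc N)) 1 =
      2 * (n + lam) * pochhammer (2 * (lam + 1) + 1) N / fact (Suc N)"
    using Suc.IH[of "lam + 1"] Suc.prems by (simp add: n_def algebra_simps)
  have "n * (n + 2 * lam) * poly (gegZ lam (Suc (Suc N))) 1 =
      ((2 * lam + 1) * (2 * (lam + 1)) * pochhammer (2 * (lam + 1) + 1) N) * (2 * (n + lam)) / fact (Suc N)"
    using gegZ_at_1_rec[of "Suc N" lam] unfolding IH n_def[symmetric] by simp
  also have "\<dots> = n * (n + 2 * lam) * (2 * (n + lam) * pochhammer (2 * lam + 1) (Suc N) / fact (Suc (Suc N)))"
    unfolding poch fact by (simp add: n_def del: fact_Suc)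
  finally show ?case
    using pos unfolding n_def by (simp only: mult_cancel_left) auto
qed

section \<open>Orthogonality\<close>

lemma geg_orthogonal_iff:
  "geg_orthogonal lam n p \<longleftrightarrow>
     degree p = n \<and> (\<forall>q. degree q < n \<longrightarrow> geg_int lam (p * q) = 0)"
  by (simp add: geg_orthogonal_def geg_int_def)

context
  fixes lam :: real
  assumes lam: "lam > -1/2"
begin

text \<open>
  Green's identity: $(1-t^2)^{\lambda+1/2}p'$ has derivative $w_\lambda$ times the operator applied to
  $p$, and $(1-t^2)\,w_\lambda = w_{\lambda+1}$. The right-hand side is symmetric in $p$ and $q$.
\<close>

lemma geg_int_geg_op:
  "geg_int lam (geg_op lam p * q) = - geg_int (lam + 1) (pderiv p * pderiv q)"
proof -
  let ?w = "[:1, 0, -1:] :: real poly" and ?x = "[:0, 1:] :: real poly"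
  have "geg_op lam p * q + ?w * (pderiv p * pderiv q) =
      ?w * pderiv (pderiv p * q) - smult (2 * lam + 1) (?x * (pderiv p * q))"
    unfolding geg_op_def pderiv_mult by (simp only: algebra_simps mult_smult_left mult_smult_right)
  then have "geg_int lam (geg_op lam p * q + ?w * (pderiv p * pderiv q)) = 0"
    using geg_int_by_parts[OF lam, of "pderiv p * q"] by (simp only:)
  then show ?thesis
    by (simp only: geg_int_add[OF lam] geg_int_Suc_lam[OF lam])
qed

lemma geg_int_geg_op_commute: "geg_int lam (geg_op lam p * q) = geg_int lam (p * geg_op lam q)"
  using geg_int_geg_op[of p q] geg_int_geg_op[of q p] by (simp add: mult.commute)

lemma geg_op_monom:
  "geg_op lam (monom 1 m) =
     smult (real m * (real m - 1)) (monom 1 (m - 2)) - smult (real m * (real m + 2 * lam)) (monom 1 m)"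
proof (rule poly_eqI)
  fix j
  consider "m = 0" | "m = 1" | k where "m = k + 2"
    by (metis One_nat_def Suc_1 add_2_eq_Suc' not0_implies_Suc)
  then show "coeff (geg_op lam (monom 1 m)) j =
    coeff (smult (real m * (real m - 1)) (monom 1 (m - 2)) -
      smult (real m * (real m + 2 * lam)) (monom 1 m)) j"
    by cases (auto simp: coeff_geg_op)
qed

text \<open>
  On monomials the operator is triangular with diagonal entries $-m(m+2\lambda)$. By symmetry,
  $\int p\,t^m w_\lambda$ times the difference of two eigenvalues is a multiple of
  $\int p\,t^{m-2}w_\lambda$, and the difference $(n-m)(n+m+2\lambda)$ is positive for $m < n$,
  since then $n + m \ge 1 > -2\lambda$.
\<close>

lemma geg_op_eigenvector_orthogonal:
  assumes eigen: "geg_op lam p = smult (- real n * (real n + 2 * lam)) p"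
    and q: "degree q < n"
  shows "geg_int lam (p * q) = 0"
proof -
  have monom: "m < n \<Longrightarrow> geg_int lam (p * monom 1 m) = 0" for m
  proof (induction m rule: less_induct)
    case (less m)
    have lower: "real m * (real m - 1) * geg_int lam (p * monom 1 (m - 2)) = 0"
    proof (cases "m < 2")
      case True
      then have "m = 0 \<or> m = 1" by linarith
      then show ?thesis by auto
    next
      case False
      then have "geg_int lam (p * monom 1 (m - 2)) = 0"
        using less.prems by (intro less.IH) auto
      then show ?thesis by (simp only: mult_zero_right)
    qed
    have "- real n * (real n + 2 * lam) * geg_int lam (p * monom 1 m) =
        geg_int lam (geg_op lam p * monom 1 m)"
      unfolding eigen by (simp only: mult_smult_left geg_int_smult[OF lam])
    also have "\<dots> = geg_int lam (p * geg_op lam (monom 1 m))"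
      by (rule geg_int_geg_op_commute)
    also have "\<dots> = - real m * (real m + 2 * lam) * geg_int lam (p * monom 1 m)"
      unfolding geg_op_monom right_diff_distrib[of p] mult_smult_right
        geg_int_diff[OF lam] geg_int_smult[OF lam] lower by simp
    finally have "(real n - real m) * (real n + real m + 2 * lam) * geg_int lam (p * monom 1 m) = 0"
      by (simp add: algebra_simps)
    moreover have "real n - real m > 0" "real n + real m + 2 * lam > 0"
      using less.prems lam by linarith+
    ultimately show ?case by simp
  qed
  have "q = (\<Sum>i\<le>degree q. smult (coeff q i) (monom 1 i))"
    using poly_as_sum_of_monoms[of q] by (simp add: smult_monom)
  then have "p * q = (\<Sum>i\<le>degree q. smult (coeff q i) (p * monom 1 i))"
    by (metis (no_types, lifting) mult_smult_right sum.cong sum_distrib_left)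
  then show ?thesis
    using q monom by (simp add: geg_int_sum[OF lam] geg_int_smult[OF lam])
qed

lemma gegZ_orthogonal: "geg_orthogonal lam n (gegZ lam n)"
  unfolding geg_orthogonal_iff
  using degree_gegZ[OF lam] geg_op_eigenvector_orthogonal[OF geg_op_gegZ] by blast

text \<open>
  The difference of the two sides has degree below $n$ (its coefficient at $n$ cancels), so it is
  orthogonal to both polynomials and hence to itself.
\<close>

lemma geg_orthogonal_unique:
  assumes "geg_orthogonal lam n p" "geg_orthogonal lam n q"
  shows "smult (lead_coeff q) p = smult (lead_coeff p) q"
proof (rule ccontr)
  define r where "r = smult (lead_coeff q) p - smult (lead_coeff p) q"
  assume "smult (lead_coeff q) p \<noteq> smult (lead_coeff p) q"
  then have r: "r \<noteq> 0" by (simp add: r_def)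
  have deg: "degree p = n" "degree q = n"
    and p: "\<And>r. degree r < n \<Longrightarrow> geg_int lam (p * r) = 0"
    and q: "\<And>r. degree r < n \<Longrightarrow> geg_int lam (q * r) = 0"
    using assms by (auto simp: geg_orthogonal_iff)
  have "coeff r n = 0" using deg by (simp add: r_def)
  moreover have "degree r \<le> n"
    unfolding r_def using deg by (intro degree_diff_le order_trans[OF degree_smult_le]) auto
  ultimately have "degree r < n"
    using r by (metis le_neq_implies_less leading_coeff_0_iff)
  have "r * r = smult (lead_coeff q) (p * r) - smult (lead_coeff p) (q * r)"
    by (subst (1) r_def) (simp add: left_diff_distrib)
  then have "geg_int lam (r * r) =
      lead_coeff q * geg_int lam (p * r) - lead_coeff p * geg_int lam (q * r)"
    by (simp only: geg_int_diff[OF lam] geg_int_smult[OF lam])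
  also have "\<dots> = 0" using p q \<open>degree r < n\<close> by simp
  finally show False using geg_int_square_pos[OF lam r] by simp
qed

end

section \<open>Identification with the orthonormal and the Gegenbauer polynomials\<close>

text \<open>
  Green's identity expresses the norm through the norm of the derivative for the parameter
  $\lambda+1$. The value at 1 obeys the same recursion (\<open>gegZ_at_1_rec\<close>), once the masses of
  $w_\lambda$ and $w_{\lambda+1}$ are compared. The induction therefore runs over the degree with
  the parameter free.
\<close>

lemma geg_int_gegZ_square:
  assumes "lam > -1/2"
  shows "geg_int lam (gegZ lam n * gegZ lam n) = geg_int lam 1 * poly (gegZ lam n) 1"
  using assms
proof (induction n arbitrary: lam)
  case (Suc N)
  note lam = \<open>lam > -1/2\<close>
  then have lam1: "lam + 1 > -1/2" by simp
  let ?Z = "gegZ lam (Suc N)" and ?Y = "gegZ (lam + 1) N"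
  define e where "e = real (Suc N) * (real (Suc N) + 2 * lam)"
  have e: "e > 0" using lam by (simp add: e_def)
  have "- e * geg_int lam (?Z * ?Z) = geg_int lam (geg_op lam ?Z * ?Z)"
    by (simp only: geg_op_gegZ mult_smult_left geg_int_smult[OF lam] e_def mult_minus_left)
  also have "\<dots> = - geg_int (lam + 1) (pderiv ?Z * pderiv ?Z)"
    by (rule geg_int_geg_op[OF lam])
  also have "\<dots> = - (2 * (lam + 1)) * (2 * (lam + 1)) * geg_int (lam + 1) (?Y * ?Y)"
    using lam by (simp only: pderiv_gegZ mult_smult_left mult_smult_right geg_int_smult[OF lam1]
        mult_minus_left mult.assoc)
  also have "geg_int (lam + 1) (?Y * ?Y) = geg_int (lam + 1) 1 * poly ?Y 1"
    using lam by (intro Suc.IH) simp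
  also have "- (2 * (lam + 1)) * (2 * (lam + 1)) * (geg_int (lam + 1) 1 * poly ?Y 1) =
      - ((2 * lam + 2) * geg_int (lam + 1) 1) * (2 * (lam + 1)) * poly ?Y 1"
    by (simp add: algebra_simps)
  also have "\<dots> = - geg_int lam 1 * ((2 * lam + 1) * (2 * (lam + 1)) * poly ?Y 1)"
    unfolding geg_int_1_Suc_lam[OF lam] by (simp add: algebra_simps)
  also have "\<dots> = - e * (geg_int lam 1 * poly ?Z 1)"
    unfolding gegZ_at_1_rec[symmetric] e_def by simp
  finally show ?case using e by simp
qed simp

lemma gegZ_at_1_pos:
  assumes "lam > -1/2"
  shows "poly (gegZ lam n) 1 > 0"
proof -
  have "gegZ lam n \<noteq> 0" using lead_coeff_gegZ_pos[OF assms, of n] by auto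
  then have "geg_int lam 1 * poly (gegZ lam n) 1 > 0"
    using geg_int_square_pos[OF assms] geg_int_gegZ_square[OF assms] by metis
  then show ?thesis using geg_int_1_pos[OF assms] by (simp add: zero_less_mult_iff)
qed

lemma geg_orthogonal_smult:
  assumes "lam > -1/2" "geg_orthogonal lam n p" "c \<noteq> 0"
  shows "geg_orthogonal lam n (smult c p)"
  using assms by (auto simp: geg_orthogonal_iff geg_int_smult)

text \<open>
  By the norm identity, $Z_n^\lambda$ has squared norm $Z_n^\lambda(1)$ for the normalized weight; so
  the two square roots in the product that defines \<open>geg_Z\<close> cancel.
\<close>

lemma geg_orthonormal_eq:
  assumes lam: "lam > -1/2"
  shows "geg_orthonormal lam n = smult (1 / sqrt (poly (gegZ lam n) 1)) (gegZ lam n)"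
proof -
  let ?d = "poly (gegZ lam n) 1"
  define a where "a = 1 / sqrt ?d"
  have d: "?d > 0" by (rule gegZ_at_1_pos[OF lam])
  then have a: "a > 0" by (simp add: a_def)
  let ?N = "\<lambda>p. geg_const lam * (LBINT t:{-1<..<1}. (poly p t)\<^sup>2 * geg_weight lam t)"
  have N: "?N p = geg_int lam (p * p) / geg_int lam 1" for p
    by (simp add: geg_const_eq[OF lam] geg_int_def power2_eq_square)
  have N_smult: "?N (smult c (gegZ lam n)) = c\<^sup>2 * ?d" for c
    using geg_int_1_pos[OF lam]
    unfolding N by (simp add: geg_int_smult[OF lam] geg_int_gegZ_square[OF lam] power2_eq_square)
  show ?thesis
    unfolding geg_orthonormal_def a_def[symmetric]
  proof (rule the_equality)
    show "geg_orthogonal lam n (smult a (gegZ lam n)) \<and> ?N (smult a (gegZ lam n)) = 1 \<and>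
        lead_coeff (smult a (gegZ lam n)) > 0"
    proof (intro conjI)
      show "geg_orthogonal lam n (smult a (gegZ lam n))"
        using geg_orthogonal_smult[OF lam gegZ_orthogonal[OF lam]] a by simp
      show "?N (smult a (gegZ lam n)) = 1"
        unfolding N_smult using d by (simp add: a_def power_divide)
      show "lead_coeff (smult a (gegZ lam n)) > 0"
        using a lead_coeff_gegZ_pos[OF lam, of n] by simp
    qed
  next
    fix p
    assume p: "geg_orthogonal lam n p \<and> ?N p = 1 \<and> lead_coeff p > 0"
    define c where "c = lead_coeff p / lead_coeff (gegZ lam n)"
    have lc: "lead_coeff (gegZ lam n) > 0" by (rule lead_coeff_gegZ_pos[OF lam])
    have c: "c > 0" using p lc by (simp add: c_def)
    have "smult (lead_coeff (gegZ lam n)) p = smult (lead_coeff p) (gegZ lam n)"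
      using geg_orthogonal_unique[OF lam] p gegZ_orthogonal[OF lam] by blast
    then have "smult (1 / lead_coeff (gegZ lam n)) (smult (lead_coeff (gegZ lam n)) p) =
        smult (1 / lead_coeff (gegZ lam n)) (smult (lead_coeff p) (gegZ lam n))"
      by (rule arg_cong)
    moreover have "gegZ lam n \<noteq> 0" using lc by auto
    ultimately have p_eq: "p = smult c (gegZ lam n)"
      by (simp add: c_def)
    have "?N p = 1" using p by blast
    then have "c\<^sup>2 * ?d = 1" unfolding p_eq N_smult .
    then have "c\<^sup>2 = a\<^sup>2" using d by (simp add: a_def power_divide field_simps)
    then have "c = a" using a c by (simp add: power2_eq_iff_nonneg)
    then show "p = smult a (gegZ lam n)" by (simp add: p_eq)
  qed
qed

lemma geg_Z_eq:
  assumes "lam > -1/2"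
  shows "geg_Z lam n t = poly (gegZ lam n) t"
  using gegZ_at_1_pos[OF assms, of n]
  by (simp add: geg_Z_def geg_orthonormal_eq[OF assms])

lemma gegC_eq_smult_gegZ:
  assumes "lam > 0"
  shows "gegC lam n = smult (lam / (real n + lam)) (gegZ lam n)"
proof -
  have "real n + lam > 0" using assms by simp
  then have "gegC lam n = smult (1 / (real n + lam)) (smult (real n + lam) (gegC lam n))"
    by simp
  also have "\<dots> = smult (lam / (real n + lam)) (gegZ lam n)"
    unfolding smult_gegC_eq_gegZ by simp
  finally show ?thesis .
qed

lemma gegC_orthogonal: "lam > 0 \<Longrightarrow> geg_orthogonal lam n (gegC lam n)"
  unfolding gegC_eq_smult_gegZ
  by (intro geg_orthogonal_smult gegZ_orthogonal) auto

lemma gegC_at_1: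
  assumes "lam > 0"
  shows "poly (gegC lam n) 1 = (real n + 2 * lam - 1) gchoose n"
proof (cases n)
  case (Suc N)
  have cancel: "lam / d * (2 * d * q / f) = 2 * lam * q / f" if "d > 0" for d q f :: real
    using that by simp
  have "lam > -1/2" using assms by simp
  then have "poly (gegC lam n) 1 = lam / (real (Suc N) + lam) *
      (2 * (real (Suc N) + lam) * pochhammer (2 * lam + 1) N / fact (Suc N))"
    by (simp only: gegC_eq_smult_gegZ[OF assms] Suc poly_smult gegZ_at_1)
  also have "\<dots> = 2 * lam * pochhammer (2 * lam + 1) N / fact (Suc N)"
    by (rule cancel) (use assms in simp)
  also have "\<dots> = pochhammer (2 * lam) n / fact n"
    by (simp only: Suc pochhammer_rec)
  finally show ?thesis
    by (simp add: gbinomial_pochhammer')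
qed simp

lemma gegenbauer_eq:
  assumes lam: "lam > 0"
  shows "gegenbauer lam n = gegC lam n"
  unfolding gegenbauer_def
proof (rule the_equality)
  show "geg_orthogonal lam n (gegC lam n) \<and> poly (gegC lam n) 1 = (real n + 2 * lam - 1) gchoose n"
    using gegC_orthogonal[OF lam] gegC_at_1[OF lam] by blast
  fix p
  assume p: "geg_orthogonal lam n p \<and> poly p 1 = (real n + 2 * lam - 1) gchoose n"
  have "poly (gegC lam n) 1 > 0"
    unfolding gegC_eq_smult_gegZ[OF lam] using lam gegZ_at_1_pos[of lam n] by simp
  then have at_1: "poly p 1 = poly (gegC lam n) 1" "poly (gegC lam n) 1 \<noteq> 0"
    using p gegC_at_1[OF lam] by simp_all
  have proportional: "smult (lead_coeff (gegC lam n)) p = smult (lead_coeff p) (gegC lam n)"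
    using geg_orthogonal_unique[of lam] lam p gegC_orthogonal[OF lam] by force
  from proportional have "lead_coeff (gegC lam n) * poly p 1 = lead_coeff p * poly (gegC lam n) 1"
    by (metis poly_smult)
  with at_1 have "lead_coeff (gegC lam n) = lead_coeff p" by simp
  moreover have "lead_coeff (gegC lam n) \<noteq> 0" using at_1(2) by auto
  ultimately show "p = gegC lam n"
    using proportional by (metis smult_eq_iff)
qed

lemma geg_int_gegC:
  assumes "mu > 0"
  shows "geg_int mu (gegC mu k) = (if k = 0 then geg_int mu 1 else 0)"
  using gegC_orthogonal[OF assms, of k] by (auto simp: geg_orthogonal_iff dest: spec[of _ 1])

section \<open>The Beta average as a convolution\<close>

lemma power_generator:
  "[:0, 2 * t, -1:] ^ m = monom 1 m * [:2 * t, -1:] ^ m" for t :: real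
proof -
  have "[:0, 2 * t, -1:] = monom 1 1 * [:2 * t, -1:]"
    by (simp add: monom_altdef)
  then show ?thesis by (simp only: power_mult_distrib monom_power power_one mult_1)
qed

text \<open>
  The variable of the polynomial \<open>[:0, 2 * t, -1:]\<close> is $r$, so this is the generating function
  $\sum_m \frac{(\nu)_m}{m!}(2rt-r^2)^m$ read off at $r^n$; since $r$ divides $2rt-r^2$, the powers with
  $m > n$ do not contribute.
\<close>

lemma poly_gegC_eq_coeff_sum:
  "poly (gegC nu n) t =
     (\<Sum>m\<le>n. pochhammer nu m / fact m * coeff ([:0, 2 * t, -1:] ^ m) n)"
proof -
  let ?g = "\<lambda>m. pochhammer nu m / fact m * coeff ([:0, 2 * t, -1:] ^ m) n"
  have g: "?g (n - k) = (if k \<le> n div 2 then (-1) ^ k * pochhammer nu (n - k) * 2 ^ (n - 2 * k) /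
     (fact k * fact (n - 2 * k)) * t ^ (n - 2 * k) else 0)" if "k \<le> n" for k
  proof -
    have c: "coeff ([:0, 2 * t, -1:] ^ (n - k)) n = coeff ([:2 * t, -1:] ^ (n - k)) k"
      using that by (simp add: power_generator coeff_monom_mult)
    show ?thesis
    proof (cases "k \<le> n div 2")
      case True
      then have k: "k \<le> n - k" and e: "n - (k + k) = n - 2 * k" by linarith+
      have "coeff ([:2 * t, -1:] ^ (n - k)) k =
          (fact (n - k) / (fact k * fact (n - 2 * k))) * (-1) ^ k * (2 * t) ^ (n - 2 * k)"
        using k by (simp add: coeff_linear_poly_power binomial_fact e)
      then show ?thesis using True unfolding c by (simp add: power_mult_distrib)
    next
      case False
      then have "degree ([:2 * t, -1:] ^ (n - k)) < k" by simp
      then show ?thesis using False unfolding c by (simp add: coeff_eq_0)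
    qed
  qed
  have "(\<Sum>m\<le>n. ?g m) = (\<Sum>k\<le>n. ?g (n - k))"
    using sum.nat_diff_reindex[of ?g "Suc n"] by (simp only: lessThan_Suc_atMost diff_Suc_Suc)
  also have "\<dots> = (\<Sum>k\<le>n. if k \<le> n div 2 then (-1) ^ k * pochhammer nu (n - k) * 2 ^ (n - 2 * k) /
     (fact k * fact (n - 2 * k)) * t ^ (n - 2 * k) else 0)"
    by (intro sum.cong refl g) simp
  also have "\<dots> = (\<Sum>k\<le>n div 2. (-1) ^ k * pochhammer nu (n - k) * 2 ^ (n - 2 * k) /
     (fact k * fact (n - 2 * k)) * t ^ (n - 2 * k))"
    by (rule sum.mono_neutral_cong_right) auto
  also have "\<dots> = poly (gegC nu n) t"
    by (simp add: gegC_def parity_poly_def poly_sum poly_monom)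
  finally show ?thesis ..
qed

text \<open>
  The coefficient of $r^n$ in the product of the generating functions of $C_k^\lambda(x)$ and
  $C_k^\mu(y)$, computed in two ways.
\<close>

lemma sum_coeff_power_products:
  "(\<Sum>m\<le>n. \<Sum>j\<le>m. pochhammer lam j / fact j * (pochhammer mu (m - j) / fact (m - j)) *
      coeff ([:0, 2 * x, -1:] ^ j * [:0, 2 * y, -1:] ^ (m - j)) n) =
   (\<Sum>k\<le>n. poly (gegC lam k) x * poly (gegC mu (n - k)) y)"
proof -
  define f where "f = (\<lambda>j i. pochhammer lam j / fact j * (pochhammer mu i / fact i) *
      coeff ([:0, 2 * x, -1:] ^ j * [:0, 2 * y, -1:] ^ i) n)"
  have f_0: "f j i = 0" if "n < j + i" for j i
  proof -
    have mono: "monom 1 (j + i) = monom 1 j * monom (1 :: real) i"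
      by (simp add: mult_monom)
    have "[:0, 2 * x, -1:] ^ j * [:0, 2 * y, -1:] ^ i =
        monom 1 (j + i) * ([:2 * x, -1:] ^ j * [:2 * y, -1:] ^ i)"
      unfolding power_generator mono by (simp only: mult_ac)
    then show ?thesis using that by (simp add: f_def coeff_monom_mult)
  qed
  then have support: "j + i \<le> n" if "f j i \<noteq> 0" for j i
    using that by (meson not_le)
  \<comment> \<open>The generating function truncated to a polynomial, which leaves its coefficients up to \<open>n\<close> unchanged.\<close>
  define P where "P = (\<lambda>a t. \<Sum>j\<le>n. smult (pochhammer a j / fact j) ([:0, 2 * t, -1:] ^ j) :: real poly)"
  have coeff_P: "coeff (P a t) k = poly (gegC a k) t" if "k \<le> n" for a t k
  proof -
    have "coeff (P a t) k = (\<Sum>j\<le>n. pochhammer a j / fact j * coeff ([:0, 2 * t, -1:] ^ j) k)"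
      by (simp add: P_def coeff_sum)
    also have "\<dots> = (\<Sum>j\<le>k. pochhammer a j / fact j * coeff ([:0, 2 * t, -1:] ^ j) k)"
      by (rule sum.mono_neutral_right) (use that in \<open>auto simp: power_generator coeff_monom_mult\<close>)
    finally show ?thesis by (simp only: poly_gegC_eq_coeff_sum)
  qed
  have "(\<Sum>m\<le>n. \<Sum>j\<le>m. f j (m - j)) = (\<Sum>(j, i)\<in>{(j, i). j + i \<le> n}. f j i)"
    by (rule sum.triangle_reindex_eq[symmetric])
  also have "\<dots> = (\<Sum>(j, i)\<in>{..n} \<times> {..n}. f j i)"
    by (rule sum.mono_neutral_left) (auto intro: support)
  also have "\<dots> = (\<Sum>j\<le>n. \<Sum>i\<le>n. f j i)"
    by (rule sum.cartesian_product[symmetric])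
  also have "\<dots> = coeff (P lam x * P mu y) n"
    by (simp add: P_def f_def sum_product coeff_sum mult_ac)
  also have "\<dots> = (\<Sum>k\<le>n. poly (gegC lam k) x * poly (gegC mu (n - k)) y)"
    by (simp add: coeff_mult coeff_P)
  finally show ?thesis by (simp add: f_def)
qed

lemma Beta_add_nat:
  fixes a b :: real
  assumes "a > 0" "b > 0"
  shows "Beta (a + real j) (b + real i) =
    Beta a b * pochhammer a j * pochhammer b i / pochhammer (a + b) (j + i)"
proof -
  have poch: "pochhammer z k = Gamma (z + real k) / Gamma z" "Gamma z > 0" "Gamma (z + real k) > 0"
    if "z > 0" for z :: real and k
    using that by (auto intro!: pochhammer_Gamma Gamma_real_pos dest: nonpos_Ints_nonpos)
  have s: "a + real j + (b + real i) = a + b + real (j + i)" by simp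
  have ab: "a + b > 0" using assms by simp
  have "Gamma a > 0" "Gamma b > 0" "Gamma (a + b) > 0" "Gamma (a + b + real (j + i)) > 0"
    using poch(2,3) assms ab by blast+
  then show ?thesis
    unfolding Beta_def s poch(1)[OF assms(1)] poch(1)[OF assms(2)] poch(1)[OF ab]
    by (simp del: of_nat_add)
qed

lemma set_integral_sum:
  fixes f :: "'i \<Rightarrow> 'a \<Rightarrow> real"
  assumes "\<And>i. i \<in> I \<Longrightarrow> set_integrable M A (f i)"
  shows "set_integrable M A (\<lambda>x. \<Sum>i\<in>I. f i x)"
    and "(LINT x:A|M. (\<Sum>i\<in>I. f i x)) = (\<Sum>i\<in>I. LINT x:A|M. f i x)"
  using assms unfolding set_integrable_def set_lebesgue_integral_def
  by (simp_all add: sum_distrib_left integral_sum)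

text \<open>
  The Beta integrals contribute $(\lambda)_j\,(\mu)_{m-j}/(\lambda+\mu)_m$. The denominator cancels
  against the coefficient $(\lambda+\mu)_m/m!$ of the generating function and $m!$ against the binomial
  coefficient, so the average of the generating function factorizes.
\<close>

lemma gegC_beta_average:
  assumes lam: "lam > 0" and mu: "mu > 0"
  shows gegC_beta_integrable: "set_integrable lborel {0<..<1}
      (\<lambda>s. poly (gegC (lam + mu) n) (s * x + (1 - s) * y) * s powr (lam - 1) * (1 - s) powr (mu - 1))"
    and gegC_beta_LBINT: "(LBINT s:{0<..<1}.
        poly (gegC (lam + mu) n) (s * x + (1 - s) * y) * s powr (lam - 1) * (1 - s) powr (mu - 1)) =
      Beta lam mu * (\<Sum>k\<le>n. poly (gegC lam k) x * poly (gegC mu (n - k)) y)"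
proof -
  define X Y where "X = [:0, 2 * x, -1:]" and "Y = [:0, 2 * y, -1:]"
  define A where "A = (\<lambda>m j. pochhammer (lam + mu) m / fact m * (real (m choose j) * coeff (X ^ j * Y ^ (m - j)) n))"
  define B where "B = (\<lambda>m j s. s powr (lam + real j - 1) * (1 - s) powr (mu + real (m - j) - 1))"
  have B_int: "set_integrable lborel {0<..<1} (B m j)" and
    B_LBINT: "(LBINT s:{0<..<1}. B m j s) = Beta (lam + real j) (mu + real (m - j))" for m j
    unfolding B_def using lam mu by (simp_all add: beta_weight_integrable beta_weight_LBINT)
  have absorb: "z ^ k * z powr (a - 1) = z powr (a + real k - 1)" if "z > 0" for z a :: real and k
  proof -
    have "a + real k - 1 = real k + (a - 1)" by simp
    then show ?thesis using that by (simp only: powr_add powr_realpow)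
  qed
  have integrand: "poly (gegC (lam + mu) n) (s * x + (1 - s) * y) * s powr (lam - 1) * (1 - s) powr (mu - 1) =
      (\<Sum>m\<le>n. \<Sum>j\<le>m. A m j * B m j s)" if "s \<in> {0<..<1}" for s
  proof -
    \<comment> \<open>The generator $2rt - r^2$ is affine in $t$ and the weights \<open>s\<close> and \<open>1 - s\<close> add up to 1.\<close>
    have gen: "[:0, 2 * (s * x + (1 - s) * y), -1:] = smult s X + smult (1 - s) Y"
      by (simp add: X_def Y_def algebra_simps)
    have "coeff ([:0, 2 * (s * x + (1 - s) * y), -1:] ^ m) n =
        (\<Sum>j\<le>m. real (m choose j) * coeff (X ^ j * Y ^ (m - j)) n * (s ^ j * (1 - s) ^ (m - j)))" for m
      unfolding gen binomial_ring
      by (simp add: coeff_sum smult_power of_nat_poly mult_ac)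
    then have "poly (gegC (lam + mu) n) (s * x + (1 - s) * y) =
        (\<Sum>m\<le>n. \<Sum>j\<le>m. A m j * (s ^ j * (1 - s) ^ (m - j)))"
      by (simp add: poly_gegC_eq_coeff_sum A_def sum_distrib_left mult_ac)
    moreover have "s ^ j * (1 - s) ^ (m - j) * (s powr (lam - 1) * (1 - s) powr (mu - 1)) = B m j s" for m j
    proof -
      have "s ^ j * s powr (lam - 1) = s powr (lam + real j - 1)"
        "(1 - s) ^ (m - j) * (1 - s) powr (mu - 1) = (1 - s) powr (mu + real (m - j) - 1)"
        using absorb[of s j lam] absorb[of "1 - s" "m - j" mu] that by simp_all
      then show ?thesis by (simp add: B_def mult_ac)
    qed
    ultimately show ?thesis
      by (simp add: sum_distrib_right mult.assoc)
  qed
  have int: "set_integrable lborel {0<..<1} (\<lambda>s. \<Sum>m\<le>n. \<Sum>j\<le>m. A m j * B m j s)"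
    by (rule set_integral_sum(1), rule set_integral_sum(1), rule set_integrable_mult_right, rule B_int)
  have "set_integrable lborel {0<..<1}
      (\<lambda>s. poly (gegC (lam + mu) n) (s * x + (1 - s) * y) * s powr (lam - 1) * (1 - s) powr (mu - 1)) \<longleftrightarrow>
      set_integrable lborel {0<..<1} (\<lambda>s. \<Sum>m\<le>n. \<Sum>j\<le>m. A m j * B m j s)"
    by (rule set_integrable_cong[OF refl refl], rule integrand)
  with int show "set_integrable lborel {0<..<1}
      (\<lambda>s. poly (gegC (lam + mu) n) (s * x + (1 - s) * y) * s powr (lam - 1) * (1 - s) powr (mu - 1))"
    by (rule iffD2[rotated])
  have "(LBINT s:{0<..<1}. poly (gegC (lam + mu) n) (s * x + (1 - s) * y) * s powr (lam - 1) * (1 - s) powr (mu - 1)) =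
      (LBINT s:{0<..<1}. \<Sum>m\<le>n. \<Sum>j\<le>m. A m j * B m j s)"
    by (rule set_lebesgue_integral_cong, simp, intro allI impI, rule integrand)
  also have "\<dots> = (\<Sum>m\<le>n. \<Sum>j\<le>m. A m j * Beta (lam + real j) (mu + real (m - j)))"
    by (simp add: set_integral_sum B_int B_LBINT)
  also have "\<dots> = (\<Sum>m\<le>n. \<Sum>j\<le>m. Beta lam mu * (pochhammer lam j / fact j *
      (pochhammer mu (m - j) / fact (m - j)) * coeff (X ^ j * Y ^ (m - j)) n))"
  proof (intro sum.cong refl)
    fix m j :: nat assume "j \<in> {..m}"
    then have j: "j \<le> m" by simp
    have "pochhammer (lam + mu) m > 0" using lam mu by (intro pochhammer_pos) simp
    moreover have "Beta (lam + real j) (mu + real (m - j)) =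
        Beta lam mu * pochhammer lam j * pochhammer mu (m - j) / pochhammer (lam + mu) m"
      using Beta_add_nat[OF lam mu, of j "m - j"] unfolding le_add_diff_inverse[OF j] .
    ultimately show "A m j * Beta (lam + real j) (mu + real (m - j)) = Beta lam mu * (pochhammer lam j / fact j *
      (pochhammer mu (m - j) / fact (m - j)) * coeff (X ^ j * Y ^ (m - j)) n)"
      using j by (simp add: A_def binomial_fact)
  qed
  also have "\<dots> = Beta lam mu * (\<Sum>k\<le>n. poly (gegC lam k) x * poly (gegC mu (n - k)) y)"
    by (simp only: sum_distrib_left[symmetric] X_def Y_def sum_coeff_power_products)
  finally show "(LBINT s:{0<..<1}.
        poly (gegC (lam + mu) n) (s * x + (1 - s) * y) * s powr (lam - 1) * (1 - s) powr (mu - 1)) =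
      Beta lam mu * (\<Sum>k\<le>n. poly (gegC lam k) x * poly (gegC mu (n - k)) y)" .
qed

lemma geg_int_gegC_convolution:
  assumes "mu > 0"
  shows "geg_int mu (\<Sum>k\<le>n. smult (poly (gegC lam k) x) (gegC mu (n - k))) =
    geg_int mu 1 * poly (gegC lam n) x"
proof -
  have "geg_int mu (\<Sum>k\<le>n. smult (poly (gegC lam k) x) (gegC mu (n - k))) =
      (\<Sum>k\<le>n. poly (gegC lam k) x * geg_int mu (gegC mu (n - k)))"
    using assms by (simp add: geg_int_sum geg_int_smult)
  also have "\<dots> = (\<Sum>k\<le>n. if k = n then geg_int mu 1 * poly (gegC lam n) x else 0)"
    by (intro sum.cong refl) (auto simp: geg_int_gegC[OF assms])
  finally show ?thesis by simp
qed

section \<open>The integral formulas\<close>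

theorem theorem1p2:
  fixes lam mu x :: real and n :: nat
  assumes "lam > - 1/2" and "mu > 0"
  shows "geg_const mu = Gamma (mu + 1) / (Gamma (1/2) * Gamma (mu + 1/2))
    \<and> (lam > 0 \<longrightarrow>
        poly (gegenbauer lam n) x =
          geg_const mu * geg_sigma lam mu *
            (LBINT y:{-1<..<1}.
              (LBINT s:{0<..<1}.
                 poly (gegenbauer (lam + mu) n) (s * x + (1 - s) * y)
                   * s powr (lam - 1) * (1 - s) powr (mu - 1))
              * geg_weight mu y))
    \<and> geg_Z lam n x =
          geg_const mu * geg_sigma (lam + 1) mu *
            (LBINT y:{-1<..<1}.
              (LBINT s:{0<..<1}.
                 geg_Z (lam + mu) n (s * x + (1 - s) * y)
                   * s powr lam * (1 - s) powr (mu - 1))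
              * geg_weight mu y)"
proof -
  have mu: "mu > -1/2" using assms by simp
  \<comment> \<open>The inner integral, as a polynomial in \<open>y\<close>.\<close>
  define R where "R = (\<lambda>l k. smult (Beta l mu) (\<Sum>i\<le>k. smult (poly (gegC l i) x) (gegC mu (k - i))))"
  have R: "(LBINT s:{0<..<1}. poly (gegC (l + mu) k) (s * x + (1 - s) * y)
      * s powr (l - 1) * (1 - s) powr (mu - 1)) = poly (R l k) y" if "l > 0" for l k y
    using gegC_beta_LBINT[OF that assms(2), of k x y] by (simp add: R_def poly_sum)
  have R_int: "geg_int mu (R l k) = Beta l mu * (geg_int mu 1 * poly (gegC l k) x)" for l k
    unfolding R_def geg_int_smult[OF mu] geg_int_gegC_convolution[OF assms(2)] ..
  have normalization: "geg_const mu * geg_sigma l mu * (Beta l mu * (geg_int mu 1 * c)) = c"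
    if "l > 0" for l c
  proof -
    have "Gamma l > 0" "Gamma mu > 0" "Gamma (l + mu) > 0"
      using that assms(2) by (auto intro!: Gamma_real_pos)
    then have "geg_sigma l mu * Beta l mu = 1" by (simp add: geg_sigma_def Beta_def)
    moreover have "geg_const mu * geg_int mu 1 = 1"
      using geg_int_1_pos[OF mu] by (simp add: geg_const_eq[OF mu])
    moreover have "geg_const mu * geg_sigma l mu * (Beta l mu * (geg_int mu 1 * c)) =
        (geg_sigma l mu * Beta l mu) * (geg_const mu * geg_int mu 1) * c" by simp
    ultimately show ?thesis by simp
  qed
  have "geg_const mu = Gamma (mu + 1) / (Gamma (1/2) * Gamma (mu + 1/2))"
    by (simp add: geg_const_eq[OF mu] geg_int_1[OF mu])
  moreover have "poly (gegenbauer lam n) x = geg_const mu * geg_sigma lam mu *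
      (LBINT y:{-1<..<1}. (LBINT s:{0<..<1}. poly (gegenbauer (lam + mu) n) (s * x + (1 - s) * y)
        * s powr (lam - 1) * (1 - s) powr (mu - 1)) * geg_weight mu y)" if "lam > 0"
    using that assms(2) normalization[OF that, of "poly (gegC lam n) x"]
    by (simp only: gegenbauer_eq add_pos_pos R geg_int_def[symmetric] R_int)
  moreover have "geg_Z lam n x = geg_const mu * geg_sigma (lam + 1) mu *
      (LBINT y:{-1<..<1}. (LBINT s:{0<..<1}. geg_Z (lam + mu) n (s * x + (1 - s) * y)
        * s powr lam * (1 - s) powr (mu - 1)) * geg_weight mu y)"
  proof -
    define l where "l = lam + 1"
    have l: "l > 0" using assms(1) by (simp add: l_def)
    define Q where "Q = R l n - (if n < 2 then 0 else R l (n - 2))"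
    have inner: "(LBINT s:{0<..<1}. geg_Z (lam + mu) n (s * x + (1 - s) * y)
        * s powr lam * (1 - s) powr (mu - 1)) = poly Q y" for y
    proof -
      let ?h = "\<lambda>k s. poly (gegC (l + mu) k) (s * x + (1 - s) * y) * s powr (l - 1) * (1 - s) powr (mu - 1)"
      have h: "set_integrable lborel {0<..<1} (?h k)" "(LBINT s:{0<..<1}. ?h k s) = poly (R l k) y" for k
        by (rule gegC_beta_integrable[OF l assms(2)], rule R[OF l])
      have "geg_Z (lam + mu) n (s * x + (1 - s) * y) * s powr lam * (1 - s) powr (mu - 1) =
          ?h n s - (if n < 2 then 0 else ?h (n - 2) s)" for s
      proof -
        have "lam + mu > -1/2" using assms by simp
        moreover have "lam + mu + 1 = l + mu" "lam = l - 1" by (simp_all add: l_def)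
        ultimately show ?thesis
          by (simp add: geg_Z_eq gegZ_eq_gegC_diff left_diff_distrib)
      qed
      then show ?thesis
        by (cases "n < 2") (simp_all only: if_True if_False set_integral_diff(2)[OF h(1) h(1)] h(2) Q_def, simp_all add: h(2))
    qed
    have "geg_const mu * geg_sigma l mu * geg_int mu Q =
        poly (gegC l n) x - (if n < 2 then 0 else poly (gegC l (n - 2)) x)"
      by (cases "n < 2") (simp_all only: Q_def if_True if_False geg_int_diff[OF mu] geg_int_0[OF mu]
        R_int right_diff_distrib normalization[OF l] mult_zero_right)
    also have "\<dots> = geg_Z lam n x"
      using assms(1) by (simp add: geg_Z_eq gegZ_eq_gegC_diff l_def)
    finally show ?thesis
      unfolding inner by (simp add: l_def geg_int_def)
  qed
  ultimately show ?thesis by blast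
qed

end
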